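(* Let $K$ be a field and let $P=K[x_1,\dots,x_n]$ be non-negatively $\mathbb{Z}$-graded by $W\in\mathrm{Mat}_{1,n}(\mathbb{Z})$. Let $G=(g_1,\dots,g_r)$ be a tuple of $W$-homogeneous polynomials such that the ideal $I=\langle g_1,\dots,g_r\rangle$ satisfies $I\cap P_0=\{0\}$. Let $S$ be the set of all indeterminates $x_i$ such that $I$ contains an $x_i$-separating polynomial, and let $D=\{\deg_W(x_i)\mid x_i\in S\}$. For every $d\in D$, let $I_d$ be the ideal generated by the elements of $W$-degree $d$ in $G$, let $Z_d$ be a best tuple of separating indeterminates (of $W$-degree $d$) for $I_d$, and let $F_d$ be a $Z_d$-separating tuple of $W$-homogeneous polynomials in $I_d$. Let $Z$ and $F$ be the concatenations of the tuples $Z_d$ and $F_d$, respectively, with $d\in D$. Then $Z$ is a best tuple of separating indeterminates for $I$, and $F$ is a $Z$-separating tuple of $W$-homogeneous polynomials in $I$.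
   Context: Grading: $W=(w_1,\dots,w_n)$ defines the $\mathbb{Z}$-grading on $P$ with $\deg_W(x_i)=w_i$; it is non-negative if all $w_i\ge 0$. $P_0$ is the degree-$0$ component. Separating: $\mathrm{Supp}(h)$ is the set of power products occurring in $h$ with nonzero coefficient; $\mathrm{LT}_\sigma(f)$ is the leading term (power product) of $f$ with respect to a term ordering $\sigma$. A polynomial $f$ is $z$-separating for an indeterminate $z$ if $f=z-h$ with $z$ dividing no term in $\mathrm{Supp}(h)$. For a tuple $Z=(z_1,\dots,z_s)$ of distinct indeterminates, a tuple $F=(f_1,\dots,f_s)\in P^s$ is $Z$-separating if there is a term ordering $\sigma$ with $\mathrm{LT}_\sigma(f_i)=z_i$ for all $i$; it is coherently $Z$-separating if $f_i=z_i-h_i$ with $z_i$ dividing no term in $\mathrm{Supp}(h_j)$ for all $i,j$. Best tuple: let $\mathfrak{M}=\langle x_1,\dots,x_n\rangle$, let $J\subseteq\mathfrak{M}$ be an ideal, and let $\mathrm{Lin}_{\mathfrak{M}}(J)$ be the $K$-vector space spanned by the standard-degree-$1$ components of the elements of $J$. Let $s\le\dim_K(\mathrm{Lin}_{\mathfrak{M}}(J))$ be the largest number such that there exist a tuple of distinct indeterminates $Z=(z_1,\dots,z_s)$ and a coherently $Z$-separating tuple of polynomials in $J$. Such a tuple $Z$ is called a best tuple of separating indeterminates for $J$. *)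

theory Defs
  imports Complex_Main "HOL-Library.Poly_Mapping"
begin

text \<open>
  Power products in the indeterminates indexed by \<open>'x\<close> are exponent vectors, so their multiplication
  is written \<open>+\<close> and the power product \<open>1\<close> is \<open>0\<close>. For a finite type \<open>'x\<close> and a field \<open>'k\<close>, the type
  \<open>('x, 'k) mpoly\<close> is the polynomial ring \<open>K[x\<^sub>1, \<dots>, x\<^sub>n]\<close> with \<open>n = CARD('x)\<close>, with the convolution
  product of \<^theory>\<open>HOL-Library.Poly_Mapping\<close>. The support \<open>Supp\<close> of a polynomial is
  \<^const>\<open>Poly_Mapping.keys\<close>.
\<close>

type_synonym 'x pp = "'x \<Rightarrow>\<^sub>0 nat"
type_synonym ('x, 'k) mpoly = "'x pp \<Rightarrow>\<^sub>0 'k"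

definition indet_pp :: "'x \<Rightarrow> 'x pp" where
  "indet_pp x = Poly_Mapping.single x 1"

definition indet :: "'x \<Rightarrow> ('x, 'k::comm_ring_1) mpoly" where
  "indet x = Poly_Mapping.single (indet_pp x) 1"

definition pp_dvd :: "'x pp \<Rightarrow> 'x pp \<Rightarrow> bool" where
  "pp_dvd s t \<longleftrightarrow> (\<exists>u. t = s + u)"


subsection \<open>Ideals and the vector space structure\<close>

abbreviation is_ideal :: "'a::comm_ring_1 set \<Rightarrow> bool" where
  "is_ideal \<equiv> module.subspace (*)"

abbreviation ideal_gen :: "'a::comm_ring_1 set \<Rightarrow> 'a set" where
  "ideal_gen \<equiv> module.span (*)"

lemma module_times: "module ((*) :: 'a::comm_ring_1 \<Rightarrow> 'a \<Rightarrow> 'a)"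
  by unfold_locales (simp_all add: algebra_simps)

definition scal :: "'k::comm_ring_1 \<Rightarrow> ('x, 'k) mpoly \<Rightarrow> ('x, 'k) mpoly" where
  "scal c f = Poly_Mapping.single 0 c * f"

lemma vector_space_scal: "vector_space (scal :: 'k::field \<Rightarrow> ('x, 'k) mpoly \<Rightarrow> ('x, 'k) mpoly)"
proof
  show "scal a (scal b f) = scal (a * b) f" for a b and f :: "('x, 'k) mpoly"
    by (simp add: scal_def mult.assoc [symmetric] mult_single)
qed (simp_all add: scal_def distrib_left distrib_right single_add)


subsection \<open>Gradings\<close>

definition wdeg :: "('x::finite \<Rightarrow> int) \<Rightarrow> 'x pp \<Rightarrow> int" where
  "wdeg W t = (\<Sum>x\<in>UNIV. W x * int (Poly_Mapping.lookup t x))"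

text \<open>The homogeneous component of degree \<open>d\<close> of \<open>P\<close>; it contains \<open>0\<close>.\<close>

definition graded_part :: "('x::finite \<Rightarrow> int) \<Rightarrow> int \<Rightarrow> ('x, 'k::comm_ring_1) mpoly set" where
  "graded_part W d = {f. \<forall>t\<in>Poly_Mapping.keys f. wdeg W t = d}"

definition w_homogeneous :: "('x::finite \<Rightarrow> int) \<Rightarrow> ('x, 'k::comm_ring_1) mpoly \<Rightarrow> bool" where
  "w_homogeneous W f \<longleftrightarrow> (\<exists>d. f \<in> graded_part W d)"

definition w_component ::
    "('x::finite \<Rightarrow> int) \<Rightarrow> int \<Rightarrow> ('x, 'k::comm_ring_1) mpoly \<Rightarrow> ('x, 'k) mpoly" where
  "w_component W d f =
     (\<Sum>t\<in>{t \<in> Poly_Mapping.keys f. wdeg W t = d}. Poly_Mapping.single t (Poly_Mapping.lookup f t))"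


subsection \<open>Term orderings\<close>

text \<open>\<open>(s, t) \<in> \<sigma>\<close> means \<open>s \<le>\<^sub>\<sigma> t\<close>.\<close>

definition term_ordering :: "('x pp \<times> 'x pp) set \<Rightarrow> bool" where
  "term_ordering \<sigma> \<longleftrightarrow> linear_order_on UNIV \<sigma> \<and> (\<forall>t. (0, t) \<in> \<sigma>) \<and>
     (\<forall>s t u. (s, t) \<in> \<sigma> \<longrightarrow> (s + u, t + u) \<in> \<sigma>)"

text \<open>Only meaningful for \<open>f \<noteq> 0\<close>.\<close>

definition leading_term :: "('x pp \<times> 'x pp) set \<Rightarrow> ('x, 'k::comm_ring_1) mpoly \<Rightarrow> 'x pp" where
  "leading_term \<sigma> f =
     (THE t. t \<in> Poly_Mapping.keys f \<and> (\<forall>s\<in>Poly_Mapping.keys f. (s, t) \<in> \<sigma>))"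


subsection \<open>Separating polynomials and separating tuples\<close>

definition separating_poly :: "'x \<Rightarrow> ('x, 'k::comm_ring_1) mpoly \<Rightarrow> bool" where
  "separating_poly z f \<longleftrightarrow>
     (\<exists>h. f = indet z - h \<and> (\<forall>t\<in>Poly_Mapping.keys h. \<not> pp_dvd (indet_pp z) t))"

definition separating_tuple :: "'x list \<Rightarrow> ('x, 'k::comm_ring_1) mpoly list \<Rightarrow> bool" where
  "separating_tuple Z F \<longleftrightarrow> distinct Z \<and> length F = length Z \<and>
     (\<exists>\<sigma>. term_ordering \<sigma> \<and>
       (\<forall>i<length Z. F ! i \<noteq> 0 \<and> leading_term \<sigma> (F ! i) = indet_pp (Z ! i)))"

definition coherently_separating_tuple :: "'x list \<Rightarrow> ('x, 'k::comm_ring_1) mpoly list \<Rightarrow> bool" where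
  "coherently_separating_tuple Z F \<longleftrightarrow> distinct Z \<and> length F = length Z \<and>
     (\<exists>H. length H = length Z \<and>
       (\<forall>i<length Z. F ! i = indet (Z ! i) - H ! i) \<and>
       (\<forall>i<length Z. \<forall>j<length Z. \<forall>t\<in>Poly_Mapping.keys (H ! j). \<not> pp_dvd (indet_pp (Z ! i)) t))"


subsection \<open>Best tuples of separating indeterminates\<close>

definition max_ideal :: "('x, 'k::comm_ring_1) mpoly set" where
  "max_ideal = ideal_gen (range indet)"

definition Lin :: "('x::finite, 'k::field) mpoly set \<Rightarrow> ('x, 'k) mpoly set" where
  "Lin J = module.span scal (w_component (\<lambda>_. 1) 1 ` J)"

definition admissible_tuple :: "('x::finite, 'k::field) mpoly set \<Rightarrow> 'x list \<Rightarrow> bool" where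
  "admissible_tuple J Z \<longleftrightarrow> length Z \<le> vector_space.dim scal (Lin J) \<and>
     (\<exists>F. set F \<subseteq> J \<and> coherently_separating_tuple Z F)"

definition best_tuple :: "('x::finite, 'k::field) mpoly set \<Rightarrow> 'x list \<Rightarrow> bool" where
  "best_tuple J Z \<longleftrightarrow> is_ideal J \<and> J \<subseteq> max_ideal \<and> admissible_tuple J Z \<and>
     (\<forall>Z'. admissible_tuple J Z' \<longrightarrow> length Z' \<le> length Z)"

end

theory Submission
  imports Defs
begin

text \<open>
  Everything takes place one positive degree \<open>d\<close> at a time. For the concatenated tuple, use a
  lexicographic ordering that ranks indeterminates by degree first and, within degree \<open>d\<close>, as in an
  ordering \<open>\<sigma>\<^sub>d\<close> witnessing that \<open>F\<^sub>d\<close> is separating: a term of degree \<open>d\<close> other than \<open>z\<close> that lies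
  below \<open>z\<close> for \<open>\<sigma>\<^sub>d\<close> only involves indeterminates ranked below \<open>z\<close>. Reducing this triangular system
  makes it coherent. For maximality, restrict a coherently separating tuple of \<open>I\<close> to its
  indeterminates of degree \<open>d\<close> and take components of degree \<open>d\<close>. Since \<open>I\<close> meets \<open>P\<^sub>0\<close> trivially,
  the generators have positive degree, so those of degree less than \<open>d\<close> only contribute terms free of
  indeterminates of degree \<open>d\<close>; discarding them leaves a coherently separating tuple in \<open>I\<^sub>d\<close>, whose
  length is at most that of \<open>Z\<^sub>d\<close>.
\<close>

interpretation ideal: module "(*) :: 'a::comm_ring_1 \<Rightarrow> 'a \<Rightarrow> 'a"
  by (rule module_times)

interpretation mpoly: vector_space "scal :: 'k::field \<Rightarrow> ('x, 'k) mpoly \<Rightarrow> ('x, 'k) mpoly"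
  by (rule vector_space_scal)

text \<open>Zero lies in every graded part; with it deleted, each homogeneous generator has a
  well-determined degree, and degree \<open>0\<close> can be excluded by looking at nonzero elements
  of the ideal.\<close>

lemma ideal_gen_delete_zero: "ideal_gen (B - {0}) = ideal_gen B"
proof
  have "x \<in> ideal_gen (B - {0})" if "x \<in> B" for x
    using that by (cases "x = 0") (simp_all add: ideal.span_zero ideal.span_base)
  then show "ideal_gen B \<subseteq> ideal_gen (B - {0})"
    by (intro ideal.span_minimal ideal.subspace_span) blast
qed (simp add: ideal.span_mono)

section \<open>Power products and monomials\<close>

lemma lookup_indet_pp: "Poly_Mapping.lookup (indet_pp x) y = (if x = y then 1 else 0)"
  by (simp add: indet_pp_def lookup_single when_def)

lemma indet_pp_inject [simp]: "indet_pp x = indet_pp y \<longleftrightarrow> x = y"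
  by (metis lookup_indet_pp zero_neq_one)

lemma pp_dvd_indet_pp: "pp_dvd (indet_pp x) t \<longleftrightarrow> Poly_Mapping.lookup t x \<noteq> 0"
proof
  assume x: "Poly_Mapping.lookup t x \<noteq> 0"
  \<comment> \<open>Exponents are naturals with truncated subtraction, so at \<open>x\<close> the
    equation depends on \<open>x\<close> occurring in \<open>t\<close>.\<close>
  have "t = indet_pp x + (t - indet_pp x)"
  proof (rule poly_mapping_eqI)
    show "Poly_Mapping.lookup t y = Poly_Mapping.lookup (indet_pp x + (t - indet_pp x)) y" for y
      using x by (cases "x = y") (simp_all add: lookup_add lookup_minus lookup_indet_pp)
  qed
  then show "pp_dvd (indet_pp x) t" unfolding pp_dvd_def by (rule exI)
next
  assume "pp_dvd (indet_pp x) t"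
  then obtain u where "t = indet_pp x + u" unfolding pp_dvd_def by (elim exE)
  then show "Poly_Mapping.lookup t x \<noteq> 0" by (simp add: lookup_add lookup_indet_pp)
qed

lemma pp_factor_indet:
  assumes "Poly_Mapping.lookup t x \<noteq> 0"
  obtains u where "t = indet_pp x + u"
  using assms unfolding pp_dvd_indet_pp [symmetric] pp_dvd_def by (elim exE)

lemma indet_mult_single: "indet x * Poly_Mapping.single t c = Poly_Mapping.single (indet_pp x + t) c"
  by (simp add: indet_def mult_single)

lemma indet_power: "indet x ^ n = Poly_Mapping.single (Poly_Mapping.single x n) 1"
  by (induction n)
    (simp_all add: indet_def indet_pp_def mult_single single_add [symmetric])

lemma lookup_indet: "Poly_Mapping.lookup (indet x) t = (if t = indet_pp x then 1 else 0)"
  by (simp add: indet_def lookup_single when_def eq_commute)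

lemma lookup_scal: "Poly_Mapping.lookup (scal c f) t = c * Poly_Mapping.lookup f t"
  unfolding scal_def mult_map_scale_conv_mult [symmetric]
  by (simp add: Poly_Mapping.map.rep_eq when_def)

lemma sum_monomials:
  fixes f :: "'a \<Rightarrow>\<^sub>0 'b::comm_monoid_add"
  shows "(\<Sum>t\<in>Poly_Mapping.keys f. Poly_Mapping.single t (Poly_Mapping.lookup f t)) = f"
  by (rule poly_mapping_eqI) (simp add: lookup_sum lookup_single when_def sum.delta in_keys_iff)

lemma mpoly_induct [case_names monomial add]:
  fixes f :: "'a \<Rightarrow>\<^sub>0 'b::comm_monoid_add"
  assumes "\<And>t c. P (Poly_Mapping.single t c)" and "\<And>f g. P f \<Longrightarrow> P g \<Longrightarrow> P (f + g)"
  shows "P f"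
proof -
  have "P (\<Sum>t\<in>T. Poly_Mapping.single t (Poly_Mapping.lookup f t))" if "finite T" for T
    using that
  proof (induction T rule: finite_induct)
    case empty
    show ?case using assms(1) [of undefined 0] by simp
  qed (simp add: assms)
  from this [of "Poly_Mapping.keys f"] show ?thesis by (simp add: sum_monomials)
qed

section \<open>Gradings\<close>

lemma wdeg_zero [simp]: "wdeg W 0 = 0"
  by (simp add: wdeg_def)

lemma wdeg_add: "wdeg W (s + t) = wdeg W s + wdeg W t"
  by (simp add: wdeg_def lookup_add algebra_simps sum.distrib)

lemma wdeg_indet_pp [simp]: "wdeg W (indet_pp x) = W x"
  by (simp add: wdeg_def lookup_indet_pp if_distrib cong: if_cong)

lemma wdeg_nonneg: "(\<And>x. 0 \<le> W x) \<Longrightarrow> 0 \<le> wdeg W t"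
  by (simp add: wdeg_def sum_nonneg)

lemma weight_le_wdeg:
  assumes "\<And>x. 0 \<le> W x" and "Poly_Mapping.lookup t x \<noteq> 0"
  shows "W x \<le> wdeg W t"
proof -
  obtain u where "t = indet_pp x + u" using assms(2) by (rule pp_factor_indet)
  then show ?thesis using wdeg_nonneg [of W u, OF assms(1)] by (simp add: wdeg_add)
qed

lemma total_degree_one:
  assumes "wdeg (\<lambda>_. 1) t = 1"
  obtains x where "t = indet_pp x"
proof -
  obtain x where "Poly_Mapping.lookup t x \<noteq> 0"
  proof (rule ccontr)
    assume "\<not> thesis"
    with that have "Poly_Mapping.lookup t x = 0" for x by blast
    then have "wdeg (\<lambda>_. 1) t = 0" by (simp add: wdeg_def)
    with assms show False by simp
  qed
  then obtain u where t: "t = indet_pp x + u" by (rule pp_factor_indet)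
  then have "wdeg (\<lambda>_. 1) u = 0" using assms by (simp add: wdeg_add)
  then have "u = 0" by (intro poly_mapping_eqI) (simp add: wdeg_def sum_nonneg_eq_0_iff)
  with t that show ?thesis by simp
qed

lemma lookup_w_component:
  "Poly_Mapping.lookup (w_component W d f) t = (if wdeg W t = d then Poly_Mapping.lookup f t else 0)"
  by (simp add: w_component_def lookup_sum lookup_single when_def sum.delta in_keys_iff)

lemma w_component_zero [simp]: "w_component W d 0 = 0"
  by (rule poly_mapping_eqI) (simp add: lookup_w_component)

lemma w_component_add: "w_component W d (f + g) = w_component W d f + w_component W d g"
  by (rule poly_mapping_eqI) (simp add: lookup_w_component lookup_add)

lemma w_component_graded: "f \<in> graded_part W e \<Longrightarrow> w_component W d f = (if e = d then f else 0)"
  by (intro poly_mapping_eqI) (auto simp: lookup_w_component graded_part_def in_keys_iff)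

lemma w_component_in_graded_part: "w_component W d f \<in> graded_part W d"
  by (auto simp: graded_part_def in_keys_iff lookup_w_component split: if_splits)

lemma single_mult_graded_part:
  "g \<in> graded_part W e \<Longrightarrow> Poly_Mapping.single t c * g \<in> graded_part W (wdeg W t + e)"
  using keys_mult [of "Poly_Mapping.single t c" g]
  by (fastforce simp: graded_part_def wdeg_add split: if_splits)

text \<open>Components are additive, and every element of the ideal is a sum of monomial multiples
  of generators. When the generator is homogeneous, such a multiple is its own component or has
  component \<open>0\<close>.\<close>

lemma w_component_ideal_gen_induct:
  assumes "f \<in> ideal_gen B"
    and "P 0" and "\<And>u v. P u \<Longrightarrow> P v \<Longrightarrow> P (u + v)"
    and "\<And>t c g. g \<in> B \<Longrightarrow> P (w_component W d (Poly_Mapping.single t c * g))"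
  shows "P (w_component W d f)"
  using assms(1)
proof (induction rule: ideal.span_induct_alt)
  case base
  show ?case using assms(2) by simp
next
  case (step a g f)
  have "P (w_component W d (a * g))"
    by (induction a rule: mpoly_induct) (simp_all add: assms step.hyps distrib_right w_component_add)
  then show ?case by (simp add: w_component_add assms(3) step.IH)
qed

lemma w_component_mem_homogeneous_ideal:
  assumes "f \<in> ideal_gen B" and "\<And>g. g \<in> B \<Longrightarrow> w_homogeneous W g"
  shows "w_component W d f \<in> ideal_gen B"
proof (rule w_component_ideal_gen_induct [OF assms(1)])
  fix t c g assume g: "g \<in> B"
  then obtain e where "g \<in> graded_part W e" using assms(2) w_homogeneous_def by blast
  then show "w_component W d (Poly_Mapping.single t c * g) \<in> ideal_gen B"
    using g by (simp add: w_component_graded [OF single_mult_graded_part] ideal.span_zero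
        ideal.span_scale ideal.span_base)
qed (simp_all add: ideal.span_zero ideal.span_add)

text \<open>Each term other than \<open>1\<close> contains an indeterminate, so each monomial of
  \<open>f\<close> is a multiple of one.\<close>

lemma mem_max_ideal:
  assumes "Poly_Mapping.lookup f 0 = 0"
  shows "f \<in> max_ideal"
proof -
  have "Poly_Mapping.single t (Poly_Mapping.lookup f t) \<in> max_ideal" if t: "t \<in> Poly_Mapping.keys f" for t
  proof -
    have "t \<noteq> 0" using t assms by (auto simp: in_keys_iff)
    then obtain x where "Poly_Mapping.lookup t x \<noteq> 0" by (metis poly_mapping_eqI lookup_zero)
    then obtain u where "t = indet_pp x + u" by (rule pp_factor_indet)
    then have "Poly_Mapping.single t (Poly_Mapping.lookup f t) =
        Poly_Mapping.single u (Poly_Mapping.lookup f t) * indet x"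
      by (simp add: indet_mult_single mult.commute)
    then show ?thesis by (simp add: max_ideal_def ideal.span_scale ideal.span_base)
  qed
  then show ?thesis
    by (subst sum_monomials [of f, symmetric]) (simp add: max_ideal_def ideal.span_sum)
qed

section \<open>Coherently separable sets of indeterminates\<close>

text \<open>The polynomial ring in the indeterminates outside \<open>A\<close>. With
  \<open>A\<close> the entries of a tuple, it is where coherence places the polynomials
  \<open>h\<close>.\<close>

definition free_of :: "'x set \<Rightarrow> ('x, 'k::comm_ring_1) mpoly set" where
  "free_of A = {f. \<forall>t\<in>Poly_Mapping.keys f. \<forall>x\<in>A. Poly_Mapping.lookup t x = 0}"

lemma free_of_add: "f \<in> free_of A \<Longrightarrow> g \<in> free_of A \<Longrightarrow> f + g \<in> free_of A"
  using Poly_Mapping.keys_add [of f g] by (fastforce simp: free_of_def)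

lemma free_of_mult: "f \<in> free_of A \<Longrightarrow> g \<in> free_of A \<Longrightarrow> f * g \<in> free_of A"
  using keys_mult [of f g] by (fastforce simp: free_of_def lookup_add)

lemma zero_free_of: "0 \<in> free_of A"
  by (simp add: free_of_def)

lemma single_zero_free_of: "Poly_Mapping.single 0 c \<in> free_of A"
  by (simp add: free_of_def)

lemma w_component_free_of: "f \<in> free_of A \<Longrightarrow> w_component W d f \<in> free_of A"
  by (auto simp: free_of_def in_keys_iff lookup_w_component split: if_splits)

text \<open>Coherence ignores the order of the tuple, so it is stated for the set of
  entries.\<close>

definition coherently_separable :: "('x, 'k::comm_ring_1) mpoly set \<Rightarrow> 'x set \<Rightarrow> bool" where
  "coherently_separable J A \<longleftrightarrow> (\<forall>z\<in>A. \<exists>h\<in>free_of A. indet z - h \<in> J)"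

lemma coherently_separating_tuple_iff:
  "(\<exists>F. set F \<subseteq> J \<and> coherently_separating_tuple Z F) \<longleftrightarrow> distinct Z \<and> coherently_separable J (set Z)"
    (is "?L \<longleftrightarrow> ?R")
proof
  assume ?L
  then obtain F H where F: "set F \<subseteq> J" "length F = length Z" "distinct Z" "length H = length Z"
    "\<forall>i<length Z. F ! i = indet (Z ! i) - H ! i"
    "\<forall>i<length Z. \<forall>j<length Z. \<forall>t\<in>Poly_Mapping.keys (H ! j). \<not> pp_dvd (indet_pp (Z ! i)) t"
    unfolding coherently_separating_tuple_def by blast
  then have "H ! i \<in> free_of (set Z)" "indet (Z ! i) - H ! i \<in> J" if "i < length Z" for i
    using that by (auto simp: free_of_def pp_dvd_indet_pp in_set_conv_nth)
      (metis nth_mem subsetD)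
  then show ?R using F(3) unfolding coherently_separable_def by (metis in_set_conv_nth)
next
  assume R: ?R
  then obtain h where h: "\<And>z. z \<in> set Z \<Longrightarrow> h z \<in> free_of (set Z)"
    "\<And>z. z \<in> set Z \<Longrightarrow> indet z - h z \<in> J"
    unfolding coherently_separable_def by metis
  have "\<not> pp_dvd (indet_pp x) t" if "x \<in> set Z" "z \<in> set Z" "t \<in> Poly_Mapping.keys (h z)" for x z t
    using h(1) [OF that(2)] that by (auto simp: free_of_def pp_dvd_indet_pp)
  then have "coherently_separating_tuple Z (map (\<lambda>z. indet z - h z) Z)"
    unfolding coherently_separating_tuple_def
    using R by (auto intro!: exI [of _ "map h Z"]) (meson nth_mem)
  then show ?L using h(2) by (intro exI [of _ "map (\<lambda>z. indet z - h z) Z"]) auto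
qed

text \<open>For a single indeterminate coherence demands only that \<open>h\<close> avoid
  \<open>z\<close> itself. This links the set \<open>S\<close> of the theorem to coherent
  tuples.\<close>

lemma separating_poly_iff:
  "(\<exists>f\<in>J. separating_poly z f) \<longleftrightarrow> coherently_separable J {z}"
  by (auto simp: separating_poly_def coherently_separable_def free_of_def pp_dvd_indet_pp)

lemma coherently_separable_subset:
  "coherently_separable J A \<Longrightarrow> B \<subseteq> A \<Longrightarrow> coherently_separable J B"
  unfolding coherently_separable_def free_of_def by blast

text \<open>The linear parts of the polynomials \<open>z - h\<close> are linearly independent, since \<open>z\<close> occurs in
  exactly one of them; so the dimension bound in the definition of a best tuple is automatic.\<close>

lemma card_coherently_separable_le_dim_Lin:
  fixes J :: "('x::finite, 'k::field) mpoly set"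
  assumes "coherently_separable J A"
  shows "card A \<le> vector_space.dim scal (Lin J)"
proof -
  obtain h where h: "\<And>z. z \<in> A \<Longrightarrow> h z \<in> free_of A" "\<And>z. z \<in> A \<Longrightarrow> indet z - h z \<in> J"
    using assms unfolding coherently_separable_def by metis
  define v where "v z = w_component (\<lambda>_. 1) 1 (indet z - h z)" for z
  have v: "Poly_Mapping.lookup (v z) (indet_pp y) = (if y = z then 1 else 0)"
    if "y \<in> A" "z \<in> A" for y z
  proof -
    \<comment> \<open>\<open>h z\<close> avoids all of \<open>A\<close>, so the linear terms from
      \<open>A\<close> in \<open>v z\<close> come from \<open>indet z\<close> alone.\<close>
    have "indet_pp y \<notin> Poly_Mapping.keys (h z)"
      using h(1) [OF that(2)] that(1) by (force simp: free_of_def lookup_indet_pp)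
    then show ?thesis
      by (simp add: v_def lookup_w_component Poly_Mapping.lookup_minus lookup_indet in_keys_iff)
  qed
  then have inj: "inj_on v A" by (intro inj_onI) (metis zero_neq_one)
  have "mpoly.independent (v ` A)"
  proof (rule mpoly.independent_if_scalars_zero)
    fix c y assume 0: "(\<Sum>x\<in>v ` A. scal (c x) x) = 0" and "y \<in> v ` A"
    then obtain z where z: "y = v z" "z \<in> A" by blast
    have "0 = Poly_Mapping.lookup (\<Sum>x\<in>A. scal (c (v x)) (v x)) (indet_pp z)"
      using 0 by (simp add: sum.reindex [OF inj])
    also have "\<dots> = (\<Sum>x\<in>A. if x = z then c (v x) else 0)"
      unfolding lookup_sum lookup_scal by (rule sum.cong) (use v z in auto)
    finally show "c y = 0" using z by (simp add: sum.delta)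
  qed simp
  moreover obtain B where B: "B \<subseteq> Lin J" "mpoly.independent B" "Lin J \<subseteq> mpoly.span B"
    "card B = mpoly.dim (Lin J)"
    by (rule mpoly.basis_exists)
  \<comment> \<open>Comparing cardinalities needs a finite spanning set; all linear components lie
    in the span of the finitely many indeterminates.\<close>
  moreover have "finite B"
  proof -
    have "w_component (\<lambda>_. 1) 1 f \<in> mpoly.span (range indet)" for f :: "('x, 'k) mpoly"
    proof (subst sum_monomials [symmetric], rule mpoly.span_sum)
      fix t assume "t \<in> Poly_Mapping.keys (w_component (\<lambda>_. 1) 1 f)"
      then have "wdeg (\<lambda>_. 1) t = 1" by (auto simp: in_keys_iff lookup_w_component split: if_splits)
      then obtain x where "t = indet_pp x" by (rule total_degree_one)
      then have "Poly_Mapping.single t c = scal c (indet x)" for c :: 'k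
        by (simp add: scal_def indet_def mult_single)
      then show "Poly_Mapping.single t (Poly_Mapping.lookup (w_component (\<lambda>_. 1) 1 f) t)
          \<in> mpoly.span (range indet)"
        by (simp add: mpoly.span_scale mpoly.span_base)
    qed
    then have "Lin J \<subseteq> mpoly.span (range indet)"
      unfolding Lin_def by (intro mpoly.span_minimal mpoly.subspace_span) blast
    then show ?thesis
      using B mpoly.independent_span_bound [of "range indet" B] by auto
  qed
  moreover have "v ` A \<subseteq> Lin J"
    using h(2) by (auto simp: Lin_def v_def intro!: mpoly.span_base)
  ultimately have "card (v ` A) \<le> mpoly.dim (Lin J)"
    using mpoly.independent_span_bound [of B "v ` A"] by (metis order_trans)
  then show ?thesis by (simp add: card_image [OF inj])
qed

lemma admissible_tuple_iff:
  "admissible_tuple J Z \<longleftrightarrow> distinct Z \<and> coherently_separable J (set Z)"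
  unfolding admissible_tuple_def coherently_separating_tuple_iff
  using card_coherently_separable_le_dim_Lin [of J "set Z"] by (auto simp: distinct_card)

section \<open>Triangular polynomials\<close>

text \<open>For injective \<open>r\<close> this makes \<open>z\<close> the leading term in
  \<open>lex_ordering r\<close>; it is phrased by ranks so that elimination can recurse on them. The
  coefficient of \<open>z\<close> may be any nonzero element.\<close>

definition triangular :: "('x \<Rightarrow> nat) \<Rightarrow> 'x \<Rightarrow> ('x, 'k::comm_ring_1) mpoly \<Rightarrow> bool" where
  "triangular r z f \<longleftrightarrow> indet_pp z \<in> Poly_Mapping.keys f \<and>
     (\<forall>t\<in>Poly_Mapping.keys f. t \<noteq> indet_pp z \<longrightarrow>
       (\<forall>y. Poly_Mapping.lookup t y \<noteq> 0 \<longrightarrow> r y < r z))"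

text \<open>Solving the triangular system: the polynomials free of \<open>A\<close> form, together with \<open>I\<close>, a subring
  that contains every indeterminate by induction on the rank, hence everything.\<close>

lemma coherently_separable_triangular:
  fixes I :: "('x, 'k::field) mpoly set"
  assumes I: "is_ideal I" and tri: "\<And>z. z \<in> A \<Longrightarrow> \<exists>f\<in>I. triangular r z f"
  shows "coherently_separable I A"
proof -
  define B where "B = {f. \<exists>a\<in>free_of A. f - a \<in> I}"
  have free: "f \<in> B" if "f \<in> free_of A" for f
    using that ideal.subspace_0 [OF I] by (auto simp: B_def intro!: bexI [of _ f])
  have add: "f + g \<in> B" if fg: "f \<in> B" "g \<in> B" for f g
  proof -
    obtain a b where ab: "a \<in> free_of A" "b \<in> free_of A" "f - a \<in> I" "g - b \<in> I"
      using fg B_def by auto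
    then have "(f - a) + (g - b) \<in> I" by (intro ideal.subspace_add [OF I])
    then show ?thesis using ab free_of_add by (auto simp: B_def algebra_simps intro!: bexI [of _ "a + b"])
  qed
  have mult: "f * g \<in> B" if fg: "f \<in> B" "g \<in> B" for f g
  proof -
    obtain a b where ab: "a \<in> free_of A" "b \<in> free_of A" "f - a \<in> I" "g - b \<in> I"
      using fg B_def by auto
    then have "g * (f - a) + a * (g - b) \<in> I"
      by (intro ideal.subspace_add [OF I] ideal.subspace_scale [OF I])
    moreover have "g * (f - a) + a * (g - b) = f * g - a * b" by (simp add: algebra_simps)
    ultimately show ?thesis using ab free_of_mult by (auto simp: B_def intro!: bexI [of _ "a * b"])
  qed
  have power: "f ^ n \<in> B" if "f \<in> B" for f n
    by (induction n) (simp_all add: that mult free free_of_def)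
  have monomial: "Poly_Mapping.single t c \<in> B"
    if "\<And>y. Poly_Mapping.lookup t y \<noteq> 0 \<Longrightarrow> indet y \<in> B" for t c
    using that
  proof (induction t rule: update_induct)
    case const
    show ?case by (simp add: free single_zero_free_of)
  next
    case (update t x n)
    \<comment> \<open>\<open>x\<close> does not occur in \<open>t\<close> yet, so setting its
      exponent to \<open>n\<close> multiplies the term by \<open>x ^ n\<close>.\<close>
    have "Poly_Mapping.update x n t = t + Poly_Mapping.single x n"
      using update.hyps
      by (intro poly_mapping_eqI)
        (auto simp: lookup_update lookup_add lookup_single when_def in_keys_iff)
    then have "Poly_Mapping.single (Poly_Mapping.update x n t) c = Poly_Mapping.single t c * indet x ^ n"
      by (simp add: indet_power mult_single)
    moreover have "indet x \<in> B" using update.prems [of x] update.hyps by (simp add: lookup_update)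
    moreover have "indet y \<in> B" if "Poly_Mapping.lookup t y \<noteq> 0" for y
      using update.prems [of y] update.hyps that by (auto simp: lookup_update split: if_splits)
    ultimately show ?case using update.IH by (simp add: mult power)
  qed
  have zero: "0 \<in> B" by (simp add: free zero_free_of)
  have sum: "(\<Sum>t\<in>T. p t) \<in> B" if "\<And>t. t \<in> T \<Longrightarrow> p t \<in> B" for p and T :: "'x pp set"
    using that by (induction T rule: infinite_finite_induct) (auto simp: zero add)
  have indets: "indet x \<in> B" for x
  proof (induction "r x" arbitrary: x rule: less_induct)
    case less
    show ?case
    proof (cases "x \<in> A")
      case False
      then show ?thesis by (intro free) (auto simp: free_of_def indet_def lookup_indet_pp)
    next
      case True
      then obtain f where f: "f \<in> I" "triangular r x f" using tri by blast
      define c where "c = Poly_Mapping.lookup f (indet_pp x)"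
      \<comment> \<open>Rescaling gives \<open>x\<close> the coefficient \<open>1\<close>, so it
        cancels and \<open>h\<close> retains only terms in indeterminates of smaller rank, which the
        induction hypothesis covers.\<close>
      define h where "h = indet x - scal (inverse c) f"
      have c: "c \<noteq> 0" using f(2) by (simp add: triangular_def c_def in_keys_iff)
      have "h \<in> B"
      proof (subst sum_monomials [of h, symmetric], rule sum, rule monomial)
        fix t y assume t: "t \<in> Poly_Mapping.keys h" and y: "Poly_Mapping.lookup t y \<noteq> 0"
        have "t \<noteq> indet_pp x"
          using t c by (auto simp: h_def in_keys_iff Poly_Mapping.lookup_minus lookup_indet lookup_scal c_def)
        moreover from this have "t \<in> Poly_Mapping.keys f"
          using t by (auto simp: h_def in_keys_iff Poly_Mapping.lookup_minus lookup_indet lookup_scal)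
        ultimately have "r y < r x" using f(2) y by (auto simp: triangular_def)
        then show "indet y \<in> B" by (rule less)
      qed
      then obtain a where a: "a \<in> free_of A" "h - a \<in> I" by (auto simp: B_def)
      have "(h - a) + scal (inverse c) f \<in> I"
        unfolding scal_def by (intro ideal.subspace_add [OF I] ideal.subspace_scale [OF I] a f)
      then have "indet x - a \<in> I" by (simp add: h_def algebra_simps)
      then show ?thesis using a(1) by (auto simp: B_def)
    qed
  qed
  then show ?thesis by (auto simp: coherently_separable_def B_def)
qed

section \<open>Lexicographic term orderings\<close>

text \<open>For injective \<open>r\<close>, \<open>x\<close> is the highest-ranked place where
  \<open>s\<close> and \<open>t\<close> differ, and it decides the comparison.\<close>

definition lex_ordering :: "('x \<Rightarrow> nat) \<Rightarrow> ('x pp \<times> 'x pp) set" where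
  "lex_ordering r = {(s, t). s = t \<or>
     (\<exists>x. Poly_Mapping.lookup s x < Poly_Mapping.lookup t x \<and>
       (\<forall>y. r x < r y \<longrightarrow> Poly_Mapping.lookup s y = Poly_Mapping.lookup t y))}"

lemma term_ordering_lex_ordering:
  fixes r :: "'x::finite \<Rightarrow> nat"
  assumes "inj r"
  shows "term_ordering (lex_ordering r)"
proof -
  have max_diff: "\<exists>x. Poly_Mapping.lookup s x \<noteq> Poly_Mapping.lookup t x \<and>
      (\<forall>y. r x < r y \<longrightarrow> Poly_Mapping.lookup s y = Poly_Mapping.lookup t y)"
    if "s \<noteq> t" for s t :: "'x pp"
  proof -
    define X where "X = {x. Poly_Mapping.lookup s x \<noteq> Poly_Mapping.lookup t x}"
    have "X \<noteq> {}" using that by (auto simp: X_def intro: poly_mapping_eqI)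
    then have "Max (r ` X) \<in> r ` X" by (intro Max_in) auto
    then obtain x where x: "x \<in> X" "r x = Max (r ` X)" by auto
    have "r y \<le> r x" if "y \<in> X" for y
      using x(2) that by simp
    then have "y \<notin> X" if "r x < r y" for y
      using that by fastforce
    with x(1) show ?thesis by (auto simp: X_def)
  qed
  have cmp: "x = y \<or> r x < r y \<or> r y < r x" for x y
    using assms by (metis injD linorder_neqE_nat)
  have "trans (lex_ordering r)"
  proof (rule transI)
    fix s t u assume st: "(s, t) \<in> lex_ordering r" and tu: "(t, u) \<in> lex_ordering r"
    show "(s, u) \<in> lex_ordering r"
    proof (cases "s = t \<or> t = u")
      case False
      obtain x where x: "Poly_Mapping.lookup s x < Poly_Mapping.lookup t x"
        "\<And>y. r x < r y \<Longrightarrow> Poly_Mapping.lookup s y = Poly_Mapping.lookup t y"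
        using st False by (auto simp: lex_ordering_def)
      obtain y where y: "Poly_Mapping.lookup t y < Poly_Mapping.lookup u y"
        "\<And>z. r y < r z \<Longrightarrow> Poly_Mapping.lookup t z = Poly_Mapping.lookup u z"
        using tu False by (auto simp: lex_ordering_def)
      \<comment> \<open>\<open>m\<close> is the higher-ranked of the two deciding places; above it
        \<open>s\<close>, \<open>t\<close> and \<open>u\<close> agree.\<close>
      define m where "m = (if r x < r y then y else x)"
      have "Poly_Mapping.lookup s m < Poly_Mapping.lookup u m"
        using x y cmp [of x y] by (auto simp: m_def dest: order.strict_trans)
      moreover have "Poly_Mapping.lookup s z = Poly_Mapping.lookup u z" if "r m < r z" for z
        using that x(2) [of z] y(2) [of z] by (auto simp: m_def split: if_splits)
      ultimately show ?thesis by (auto simp: lex_ordering_def)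
    qed (use st tu in auto)
  qed
  moreover have "antisym (lex_ordering r)"
  proof (rule antisymI, rule ccontr)
    fix s t assume "(s, t) \<in> lex_ordering r" "(t, s) \<in> lex_ordering r" "s \<noteq> t"
    then obtain x y where "Poly_Mapping.lookup s x < Poly_Mapping.lookup t x"
        "\<And>y. r x < r y \<Longrightarrow> Poly_Mapping.lookup s y = Poly_Mapping.lookup t y"
        "Poly_Mapping.lookup t y < Poly_Mapping.lookup s y"
        "\<And>z. r y < r z \<Longrightarrow> Poly_Mapping.lookup t z = Poly_Mapping.lookup s z"
      by (auto simp: lex_ordering_def)
    then show False using cmp [of x y] by (metis less_irrefl less_asym)
  qed
  moreover have "total (lex_ordering r)"
  proof (rule totalI)
    fix s t :: "'x pp" assume "s \<noteq> t"
    then show "(s, t) \<in> lex_ordering r \<or> (t, s) \<in> lex_ordering r"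
      using max_diff [of s t] by (auto simp: lex_ordering_def) (metis linorder_neqE_nat)
  qed
  moreover have "refl (lex_ordering r)" by (auto simp: lex_ordering_def intro: refl_onI)
  moreover have "(0, t) \<in> lex_ordering r" for t
    using max_diff [of 0 t] by (auto simp: lex_ordering_def)
  moreover have "(s + u, t + u) \<in> lex_ordering r" if "(s, t) \<in> lex_ordering r" for s t u
    using that by (auto simp: lex_ordering_def lookup_add)
  ultimately show ?thesis by (auto simp: term_ordering_def order_on_defs)
qed

lemma term_ordering_exists: "\<exists>\<sigma> :: ('x::finite pp \<times> 'x pp) set. term_ordering \<sigma>"
proof -
  obtain r :: "'x \<Rightarrow> nat" where "inj r"
    using finite_imp_inj_to_nat_seg [of "UNIV :: 'x set"] by auto
  then show ?thesis by (blast intro: term_ordering_lex_ordering)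
qed

section \<open>Leading terms for an arbitrary term ordering\<close>

lemma term_ordering_antisym:
  "term_ordering \<sigma> \<Longrightarrow> (s, t) \<in> \<sigma> \<Longrightarrow> (t, s) \<in> \<sigma> \<Longrightarrow> s = t"
  by (auto simp: term_ordering_def order_on_defs dest: antisymD)

lemma term_ordering_trans:
  "term_ordering \<sigma> \<Longrightarrow> (s, t) \<in> \<sigma> \<Longrightarrow> (t, u) \<in> \<sigma> \<Longrightarrow> (s, u) \<in> \<sigma>"
  by (auto simp: term_ordering_def order_on_defs dest: transD)

lemma term_ordering_total: "term_ordering \<sigma> \<Longrightarrow> (s, t) \<in> \<sigma> \<or> (t, s) \<in> \<sigma>"
  by (cases "s = t") (auto simp: term_ordering_def order_on_defs total_on_def refl_on_def)

lemma term_ordering_le_add: "term_ordering \<sigma> \<Longrightarrow> (s, s + u) \<in> \<sigma>"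
  unfolding term_ordering_def by (metis add_0 add.commute)

lemma leading_term_eq:
  assumes "term_ordering \<sigma>" and "t \<in> Poly_Mapping.keys f" and "\<And>s. s \<in> Poly_Mapping.keys f \<Longrightarrow> (s, t) \<in> \<sigma>"
  shows "leading_term \<sigma> f = t"
  unfolding leading_term_def
  by (rule the_equality) (use assms in \<open>auto intro: term_ordering_antisym\<close>)

text \<open>Justifies the definite description: a finite nonempty set has a maximum in a total
  ordering.\<close>

lemma leading_term_greatest:
  assumes \<sigma>: "term_ordering \<sigma>" and "f \<noteq> 0"
  shows "leading_term \<sigma> f \<in> Poly_Mapping.keys f"
    and "s \<in> Poly_Mapping.keys f \<Longrightarrow> (s, leading_term \<sigma> f) \<in> \<sigma>"
proof -
  have "\<exists>t\<in>T. \<forall>s\<in>T. (s, t) \<in> \<sigma>" if "finite T" "T \<noteq> {}" for T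
    using that
  proof (induction rule: finite_ne_induct)
    case (singleton x)
    then show ?case using term_ordering_total [OF \<sigma>] by blast
  next
    case (insert x T)
    then show ?case
      by (metis insert_iff term_ordering_total [OF \<sigma>] term_ordering_trans [OF \<sigma>])
  qed
  from this [of "Poly_Mapping.keys f"] obtain t
    where "t \<in> Poly_Mapping.keys f" "\<And>s. s \<in> Poly_Mapping.keys f \<Longrightarrow> (s, t) \<in> \<sigma>"
    using \<open>f \<noteq> 0\<close> by auto
  with leading_term_eq [OF \<sigma>] show "leading_term \<sigma> f \<in> Poly_Mapping.keys f"
    and "s \<in> Poly_Mapping.keys f \<Longrightarrow> (s, leading_term \<sigma> f) \<in> \<sigma>"
    by auto
qed

text \<open>A term in indeterminates ranked below \<open>z\<close> agrees with \<open>z\<close> in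
  all places above \<open>z\<close> and has exponent \<open>0\<close> at \<open>z\<close>, hence is
  smaller.\<close>

lemma leading_term_triangular:
  fixes r :: "'x::finite \<Rightarrow> nat"
  assumes r: "inj r" and f: "triangular r z f"
  shows "f \<noteq> 0 \<and> leading_term (lex_ordering r) f = indet_pp z"
proof
  show "f \<noteq> 0" using f by (auto simp: triangular_def)
  show "leading_term (lex_ordering r) f = indet_pp z"
  proof (rule leading_term_eq [OF term_ordering_lex_ordering [OF r]])
    fix t assume "t \<in> Poly_Mapping.keys f"
    with f have "t = indet_pp z \<or> (\<forall>y. Poly_Mapping.lookup t y \<noteq> 0 \<longrightarrow> r y < r z)"
      by (auto simp: triangular_def)
    then show "(t, indet_pp z) \<in> lex_ordering r"
      by (fastforce simp: lex_ordering_def lookup_indet_pp intro!: exI [of _ z])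
  qed (use f in \<open>simp add: triangular_def\<close>)
qed

lemma separating_tuple_triangular:
  fixes r :: "'x::finite \<Rightarrow> nat"
  assumes "inj r" "distinct Z" "list_all2 (triangular r) Z F"
  shows "separating_tuple Z F"
  unfolding separating_tuple_def
  using assms(2,3) term_ordering_lex_ordering [OF assms(1)] leading_term_triangular [OF assms(1)]
  unfolding list_all2_conv_all_nth by metis

text \<open>Rank by weight first, then among indeterminates of weight \<open>d\<close> as in the ordering \<open>\<sigma> d\<close>.\<close>

lemma rank_of_term_orderings:
  fixes W :: "'x::finite \<Rightarrow> int"
  assumes W: "\<And>x. 0 \<le> W x" and \<sigma>: "\<And>d. term_ordering (\<sigma> d)"
  obtains r :: "'x \<Rightarrow> nat" where "inj r" "\<And>x y. W x < W y \<Longrightarrow> r x < r y"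
    "\<And>x y. W x = W y \<Longrightarrow> (indet_pp x, indet_pp y) \<in> \<sigma> (W y) \<Longrightarrow> x \<noteq> y \<Longrightarrow> r x < r y"
proof
  \<comment> \<open>The position of \<open>x\<close> in the ordering attached to its own weight,
    counted among all indeterminates.\<close>
  define g where "g x = card {u. (indet_pp u, indet_pp x) \<in> \<sigma> (W x)}" for x
  \<comment> \<open>The factor exceeds every value of \<open>g\<close>, so a difference in weight
    outweighs any difference in position.\<close>
  define r where "r x = nat (W x) * Suc (card (UNIV :: 'x set)) + g x" for x
  have g: "g x < Suc (card (UNIV :: 'x set))" for x
    by (simp add: g_def less_Suc_eq_le card_mono)
  show *: "r x < r y" if "W x < W y" for x y
  proof -
    have "Suc (nat (W x)) * Suc (card (UNIV :: 'x set)) \<le> nat (W y) * Suc (card (UNIV :: 'x set))"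
      using that W [of x] by (intro mult_le_mono1) linarith
    then show ?thesis using g [of x] by (simp add: r_def)
  qed
  show **: "r x < r y" if "W x = W y" "(indet_pp x, indet_pp y) \<in> \<sigma> (W y)" "x \<noteq> y" for x y
  proof -
    have "{u. (indet_pp u, indet_pp x) \<in> \<sigma> (W x)} \<subset> {u. (indet_pp u, indet_pp y) \<in> \<sigma> (W y)}"
    proof
      show "{u. (indet_pp u, indet_pp x) \<in> \<sigma> (W x)} \<subseteq> {u. (indet_pp u, indet_pp y) \<in> \<sigma> (W y)}"
        using that term_ordering_trans [OF \<sigma>] by auto
      have "(indet_pp y, indet_pp x) \<notin> \<sigma> (W x)" "(indet_pp y, indet_pp y) \<in> \<sigma> (W y)"
        using that term_ordering_antisym [OF \<sigma>] term_ordering_total [OF \<sigma>] by (metis indet_pp_inject)+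
      then show "{u. (indet_pp u, indet_pp x) \<in> \<sigma> (W x)} \<noteq> {u. (indet_pp u, indet_pp y) \<in> \<sigma> (W y)}"
        by auto
    qed
    then have "g x < g y" unfolding g_def by (intro psubset_card_mono) auto
    then show ?thesis using that(1) by (simp add: r_def)
  qed
  show "inj r"
  proof (rule injI, rule ccontr)
    fix x y assume "r x = r y" "x \<noteq> y"
    then show False
      using * ** term_ordering_total [OF \<sigma>] by (metis less_irrefl linorder_neqE)
  qed
qed

text \<open>Homogeneity forces every indeterminate in a term \<open>t\<close> of \<open>f\<close> to
  have weight at most \<open>W z\<close>. One of equal weight is at most \<open>t\<close>, which is
  at most \<open>z\<close>, in \<open>\<sigma>\<close>.\<close>

lemma triangular_homogeneous:
  fixes W :: "'x::finite \<Rightarrow> int"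
  assumes W: "\<And>x. 0 \<le> W x" and \<sigma>: "term_ordering \<sigma>"
    and f: "w_homogeneous W f" "f \<noteq> 0" "leading_term \<sigma> f = indet_pp z"
    and r: "\<And>x. W x < W z \<Longrightarrow> r x < r z"
      "\<And>x. W x = W z \<Longrightarrow> (indet_pp x, indet_pp z) \<in> \<sigma> \<Longrightarrow> x \<noteq> z \<Longrightarrow> r x < r z"
  shows "triangular r z f"
  unfolding triangular_def
proof (intro conjI ballI impI allI)
  note LT = leading_term_greatest [OF \<sigma> f(2), unfolded f(3)]
  show z: "indet_pp z \<in> Poly_Mapping.keys f" by (rule LT)
  fix t y assume t: "t \<in> Poly_Mapping.keys f" "t \<noteq> indet_pp z" and y: "Poly_Mapping.lookup t y \<noteq> 0"
  obtain e where "f \<in> graded_part W e" using f(1) by (auto simp: w_homogeneous_def)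
  then have "wdeg W t = wdeg W (indet_pp z)"
    using z t(1) by (simp only: graded_part_def mem_Collect_eq)
  then have "W y \<le> W z" using weight_le_wdeg [of W, OF W y] by simp
  obtain u where u: "t = indet_pp y + u" using y by (rule pp_factor_indet)
  have tz: "(t, indet_pp z) \<in> \<sigma>" by (rule LT(2) [OF t(1)])
  have yt: "(indet_pp y, t) \<in> \<sigma>" unfolding u by (rule term_ordering_le_add [OF \<sigma>])
  have "(indet_pp y, indet_pp z) \<in> \<sigma>" by (rule term_ordering_trans [OF \<sigma> yt tz])
  \<comment> \<open>With \<open>y = z\<close>, the term \<open>t\<close> would be both above and
    below \<open>z\<close>, hence equal to it.\<close>
  moreover have "y \<noteq> z" using term_ordering_antisym [OF \<sigma> tz] yt t(2) by blast
  ultimately show "r y < r z" using \<open>W y \<le> W z\<close> r [of y] by linarith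
qed

section \<open>Restriction to one degree\<close>

text \<open>In degree \<open>d\<close>, a generator of smaller (positive) degree contributes products of two factors of
  positive degree less than \<open>d\<close>, in which no indeterminate of degree \<open>d\<close> can occur.\<close>

lemma w_component_modulo_degree_generators:
  fixes W :: "'x::finite \<Rightarrow> int"
  assumes W: "\<And>x. 0 \<le> W x" and B: "\<And>g. g \<in> B \<Longrightarrow> \<exists>e>0. g \<in> graded_part W e"
    and f: "f \<in> ideal_gen B"
  shows "\<exists>v\<in>free_of {x. W x = d}. w_component W d f - v \<in> ideal_gen (B \<inter> graded_part W d)"
proof (rule w_component_ideal_gen_induct [OF f])
  show "\<exists>v\<in>free_of {x. W x = d}. 0 - v \<in> ideal_gen (B \<inter> graded_part W d)"
    using zero_free_of ideal.span_zero by (metis diff_zero)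
next
  fix p q
  assume "\<exists>v\<in>free_of {x. W x = d}. p - v \<in> ideal_gen (B \<inter> graded_part W d)"
    and "\<exists>v\<in>free_of {x. W x = d}. q - v \<in> ideal_gen (B \<inter> graded_part W d)"
  then obtain v w where vw: "v \<in> free_of {x. W x = d}" "w \<in> free_of {x. W x = d}"
    "p - v \<in> ideal_gen (B \<inter> graded_part W d)" "q - w \<in> ideal_gen (B \<inter> graded_part W d)" by blast
  have "(p - v) + (q - w) \<in> ideal_gen (B \<inter> graded_part W d)"
    by (rule ideal.span_add [OF vw(3,4)])
  then show "\<exists>v\<in>free_of {x. W x = d}. p + q - v \<in> ideal_gen (B \<inter> graded_part W d)"
    using free_of_add [OF vw(1,2)] by (metis add_diff_add)
next
  fix t c g assume g: "g \<in> B"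
  define p where "p = Poly_Mapping.single t c * g"
  obtain e where e: "e > 0" "g \<in> graded_part W e" using B [OF g] by blast
  have p: "p \<in> graded_part W (wdeg W t + e)" unfolding p_def by (rule single_mult_graded_part [OF e(2)])
  \<comment> \<open>A generator of degree \<open>e > d\<close> falls under the second case, as
    \<open>t\<close> has nonnegative degree.\<close>
  consider "e = d" | "wdeg W t + e \<noteq> d" | "e < d" "wdeg W t + e = d"
    using wdeg_nonneg [of W t, OF W] by linarith
  then have "\<exists>v\<in>free_of {x. W x = d}. w_component W d p - v \<in> ideal_gen (B \<inter> graded_part W d)"
  proof cases
    case 1
    have "p \<in> ideal_gen (B \<inter> graded_part W d)"
      unfolding p_def using g e 1 by (intro ideal.span_scale ideal.span_base) auto
    then have "w_component W d p \<in> ideal_gen (B \<inter> graded_part W d)"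
      by (simp add: w_component_graded [OF p] ideal.span_zero)
    then show ?thesis using zero_free_of by (metis diff_zero)
  next
    case 2
    then have "w_component W d p - 0 \<in> ideal_gen (B \<inter> graded_part W d)"
      by (simp add: w_component_graded [OF p] ideal.span_zero)
    then show ?thesis using zero_free_of by blast
  next
    case 3
    \<comment> \<open>\<open>t\<close> has degree \<open>d - e < d\<close> and each term of
      \<open>g\<close> has degree \<open>e < d\<close>, so neither factor has room for an
      indeterminate of weight \<open>d\<close>.\<close>
    have "p \<in> free_of {x. W x = d}"
      unfolding free_of_def
    proof (intro CollectI ballI, clarify, rule ccontr)
      fix s x assume "s \<in> Poly_Mapping.keys p" and x: "Poly_Mapping.lookup s x \<noteq> 0" and d: "d = W x"
      then obtain u where u: "s = t + u" "u \<in> Poly_Mapping.keys g"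
        unfolding p_def using keys_mult [of "Poly_Mapping.single t c" g] by (auto split: if_splits)
      have "wdeg W u = e" using e(2) u(2) by (simp add: graded_part_def)
      then show False
        using x weight_le_wdeg [of W, OF W, of t x] weight_le_wdeg [of W, OF W, of u x] 3 e(1)
        unfolding u lookup_add d by auto
    qed
    moreover have "w_component W d p - p \<in> ideal_gen (B \<inter> graded_part W d)"
      using 3 by (simp add: w_component_graded [OF p] ideal.span_zero)
    ultimately show ?thesis by blast
  qed
  then show "\<exists>v\<in>free_of {x. W x = d}. w_component W d (Poly_Mapping.single t c * g) - v
      \<in> ideal_gen (B \<inter> graded_part W d)"
    by (simp add: p_def)
qed

text \<open>The component of degree \<open>d\<close> keeps \<open>z\<close> because \<open>z\<close>
  has weight \<open>d\<close>; the remainder \<open>v\<close> avoids everything of weight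
  \<open>d\<close>, hence \<open>A\<close>, and can be absorbed into \<open>h\<close>.\<close>

lemma coherently_separable_degree_generators:
  fixes W :: "'x::finite \<Rightarrow> int" and B :: "('x, 'k::comm_ring_1) mpoly set"
  assumes W: "\<And>x. 0 \<le> W x" and B: "\<And>g. g \<in> B \<Longrightarrow> \<exists>e>0. g \<in> graded_part W e"
    and A: "coherently_separable (ideal_gen B) A" "A \<subseteq> {x. W x = d}"
  shows "coherently_separable (ideal_gen (B \<inter> graded_part W d)) A"
  unfolding coherently_separable_def
proof
  fix z assume z: "z \<in> A"
  then obtain h where h: "h \<in> free_of A" "indet z - h \<in> ideal_gen B"
    using A(1) by (auto simp: coherently_separable_def)
  obtain v where v: "v \<in> free_of {x. W x = d}"
    "w_component W d (indet z - h) - v \<in> ideal_gen (B \<inter> graded_part W d)"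
    using w_component_modulo_degree_generators [OF W B h(2), where d = d] by blast
  have "v \<in> free_of A" using v(1) A(2) by (auto simp: free_of_def)
  then have "w_component W d h + v \<in> free_of A"
    by (rule free_of_add [OF w_component_free_of [OF h(1)]])
  moreover have "w_component W d (indet z - h) - v = indet z - (w_component W d h + v)"
    using z A(2)
    by (intro poly_mapping_eqI)
      (auto simp: lookup_w_component Poly_Mapping.lookup_minus lookup_add lookup_indet)
  ultimately show "\<exists>h\<in>free_of A. indet z - h \<in> ideal_gen (B \<inter> graded_part W d)"
    using v(2) by metis
qed

section \<open>Assembling the degrees\<close>

lemma list_all2_concat_map:
  "(\<And>d. d \<in> set ds \<Longrightarrow> list_all2 R (f d) (g d)) \<Longrightarrow>
    list_all2 R (concat (map f ds)) (concat (map g ds))"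
  by (induction ds) (auto intro: list_all2_appendI)

theorem mainTheorem7:
  fixes W :: "'x::finite \<Rightarrow> int"
    and G :: "('x, 'k::field) mpoly list"
    and I :: "('x, 'k) mpoly set"
    and S :: "'x set"
    and D :: "int set"
    and J :: "int \<Rightarrow> ('x, 'k) mpoly set"
    and Zd :: "int \<Rightarrow> 'x list"
    and Fd :: "int \<Rightarrow> ('x, 'k) mpoly list"
    and ds :: "int list"
    and Z :: "'x list"
    and F :: "('x, 'k) mpoly list"
  assumes "\<forall>x. 0 \<le> W x"
    and "\<forall>g\<in>set G. w_homogeneous W g"
    and "I = ideal_gen (set G)"
    and "I \<inter> graded_part W 0 = {0}"
    and "S = {x. \<exists>f\<in>I. separating_poly x f}"
    and "D = W ` S"
    and "\<forall>d\<in>D. J d = ideal_gen (set G \<inter> graded_part W d)"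
    and "\<forall>d\<in>D. best_tuple (J d) (Zd d) \<and> (\<forall>z\<in>set (Zd d). W z = d)"
    and "\<forall>d\<in>D. separating_tuple (Zd d) (Fd d) \<and> set (Fd d) \<subseteq> J d \<and>
           (\<forall>f\<in>set (Fd d). w_homogeneous W f)"
    and "distinct ds" and "set ds = D"
    and "Z = concat (map Zd ds)"
    and "F = concat (map Fd ds)"
  shows "best_tuple I Z \<and>
    separating_tuple Z F \<and> set F \<subseteq> I \<and> (\<forall>f\<in>set F. w_homogeneous W f)"
proof -
  note W = assms(1) [rule_format] and hom = assms(2) [rule_format] and ds = assms(10,11)
  have I: "is_ideal I" unfolding assms(3) by (rule ideal.subspace_span)
  \<comment> \<open>A nonzero generator of degree \<open>0\<close> would lie in the intersection of
    \<open>I\<close> with \<open>P_0\<close>.\<close>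
  have pos: "\<exists>e>0. g \<in> graded_part W e" if g: "g \<in> set G - {0}" for g
  proof -
    obtain e where e: "g \<in> graded_part W e"
      using hom [of g] g unfolding w_homogeneous_def by blast
    obtain t where t: "t \<in> Poly_Mapping.keys g" using g by fastforce
    have "e \<ge> 0" using e t wdeg_nonneg [of W t, OF W] by (auto simp: graded_part_def)
    moreover have "g \<in> I" using g by (simp add: assms(3) ideal.span_base)
    then have "e \<noteq> 0" using e g assms(4) by auto
    ultimately show ?thesis using e by (intro exI [of _ e]) auto
  qed
  have *: "(set G - {0}) \<inter> graded_part W d = set G \<inter> graded_part W d - {0}" for d by blast
  have I_gen: "I = ideal_gen (set G - {0})" and J_gen: "ideal_gen (set G \<inter> graded_part W d) =
    ideal_gen ((set G - {0}) \<inter> graded_part W d)" for d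
    by (simp_all add: assms(3) * ideal_gen_delete_zero)
  have I_max: "I \<subseteq> max_ideal"
  proof
    fix f assume "f \<in> I"
    \<comment> \<open>\<open>I\<close> is generated by homogeneous elements, so it contains the
      component of degree \<open>0\<close>; that component vanishes and carries the constant term of
      \<open>f\<close>.\<close>
    then have "w_component W 0 f \<in> I \<inter> graded_part W 0"
      unfolding assms(3) using w_component_mem_homogeneous_ideal [OF _ hom] w_component_in_graded_part
      by blast
    then have "w_component W 0 f = 0" using assms(4) by blast
    then have "Poly_Mapping.lookup (w_component W 0 f) 0 = 0" by simp
    then show "f \<in> max_ideal" by (intro mem_max_ideal) (simp add: lookup_w_component)
  qed
  have J_I: "J d \<subseteq> I" if "d \<in> D" for d
    using that assms(3,7) by (simp add: ideal.span_mono)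
  have F_I: "set F \<subseteq> I" using J_I assms(9,13) ds(2) by fastforce
  have F_hom: "\<forall>f\<in>set F. w_homogeneous W f" using assms(9,13) ds(2) by auto
  have Zd_W: "W z = d" if "d \<in> D" "z \<in> set (Zd d)" for d z
    using that assms(8) by blast
  have Zd_dist: "distinct (Zd d)" if "d \<in> D" for d
    using that assms(9) by (simp add: separating_tuple_def)
  \<comment> \<open>Entries of tuples for different degrees differ since their weights do.\<close>
  have Z_dist: "distinct Z"
    unfolding assms(12) using ds Zd_W Zd_dist
    by (induction ds arbitrary: D) (auto, metis)
  \<comment> \<open>\<open>\<sigma>0\<close> serves the degrees outside \<open>D\<close>, so that an
    ordering can be chosen for every integer.\<close>
  obtain \<sigma>0 :: "('x pp \<times> 'x pp) set" where "term_ordering \<sigma>0" using term_ordering_exists by blast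
  then have "\<forall>d. \<exists>\<sigma>. term_ordering \<sigma> \<and> (d \<in> D \<longrightarrow> (\<forall>i<length (Zd d).
      Fd d ! i \<noteq> 0 \<and> leading_term \<sigma> (Fd d ! i) = indet_pp (Zd d ! i)))"
    using assms(9) unfolding separating_tuple_def by blast
  then obtain \<sigma> where \<sigma>: "\<And>d. term_ordering (\<sigma> d)"
    "\<And>d i. d \<in> D \<Longrightarrow> i < length (Zd d) \<Longrightarrow>
      Fd d ! i \<noteq> 0 \<and> leading_term (\<sigma> d) (Fd d ! i) = indet_pp (Zd d ! i)"
    by metis
  obtain r :: "'x \<Rightarrow> nat" where r: "inj r" "\<And>x y. W x < W y \<Longrightarrow> r x < r y"
    "\<And>x y. W x = W y \<Longrightarrow> (indet_pp x, indet_pp y) \<in> \<sigma> (W y) \<Longrightarrow> x \<noteq> y \<Longrightarrow> r x < r y"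
    using rank_of_term_orderings [of W \<sigma>, OF W \<sigma>(1)] by blast
  have "list_all2 (triangular r) (Zd d) (Fd d)" if d: "d \<in> D" for d
    unfolding list_all2_conv_all_nth
  proof (intro conjI allI impI)
    show len: "length (Zd d) = length (Fd d)" using assms(9) d by (simp add: separating_tuple_def)
    fix i assume i: "i < length (Zd d)"
    have "W (Zd d ! i) = d" using Zd_W d i by simp
    moreover have "w_homogeneous W (Fd d ! i)" using assms(9) d i len by simp
    ultimately show "triangular r (Zd d ! i) (Fd d ! i)"
      using \<sigma>(2) [OF d i] r by (intro triangular_homogeneous [OF W \<sigma>(1) [of d]]) auto
  qed
  then have tri: "list_all2 (triangular r) Z F"
    unfolding assms(12,13) by (intro list_all2_concat_map) (simp add: ds)
  \<comment> \<open>\<open>F\<close> itself may fail to be coherent; eliminating with it yields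
    other polynomials in \<open>I\<close> that are coherent for the same \<open>Z\<close>.\<close>
  have Z_coh: "coherently_separable I (set Z)"
  proof (rule coherently_separable_triangular [OF I])
    fix z assume "z \<in> set Z"
    then show "\<exists>f\<in>I. triangular r z f"
      using tri F_I by (metis in_set_conv_nth list_all2_conv_all_nth nth_mem subsetD)
  qed
  have "length Z' \<le> length Z" if Z': "admissible_tuple I Z'" for Z'
  proof -
    have Z'_coh: "coherently_separable I (set Z')" and "distinct Z'"
      using Z' by (simp_all add: admissible_tuple_iff)
    \<comment> \<open>\<open>Z'\<close> is cut into its parts of equal weight, each compared with
      the best tuple of that degree.\<close>
    define Y where "Y d = {z \<in> set Z'. W z = d}" for d
    have Y: "card (Y d) \<le> length (Zd d)" if d: "d \<in> D" for d
    proof -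
      have "coherently_separable I (Y d)"
        using coherently_separable_subset [OF Z'_coh] by (auto simp: Y_def)
      then have "coherently_separable (J d) (Y d)"
        using coherently_separable_degree_generators [of W "set G - {0}" "Y d" d, OF W pos] assms(7) d
        by (auto simp: I_gen J_gen Y_def)
      moreover obtain ys where ys: "set ys = Y d" "distinct ys"
        using finite_distinct_list [of "Y d"] by (auto simp: Y_def)
      ultimately have "admissible_tuple (J d) ys" by (simp add: admissible_tuple_iff)
      then have "length ys \<le> length (Zd d)" using assms(8) d by (auto simp: best_tuple_def)
      then show ?thesis using ys distinct_card by metis
    qed
    \<comment> \<open>Each entry of \<open>Z'\<close> has a separating polynomial in
      \<open>I\<close>, so its weight lies in \<open>D\<close> and no part is lost.\<close>
    have "z \<in> S" if "z \<in> set Z'" for z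
      using coherently_separable_subset [OF Z'_coh, of "{z}"] that
      by (simp add: assms(5) separating_poly_iff)
    then have "set Z' = (\<Union>d\<in>D. Y d)" by (auto simp: Y_def assms(6))
    then have "card (set Z') \<le> (\<Sum>d\<in>D. card (Y d))" using ds by (metis card_UN_le finite_set)
    also have "\<dots> \<le> (\<Sum>d\<in>D. length (Zd d))" by (rule sum_mono) (rule Y)
    also have "\<dots> = length Z"
      using ds by (simp add: assms(12) length_concat comp_def sum_list_distinct_conv_sum_set)
    finally show ?thesis using \<open>distinct Z'\<close> by (simp add: distinct_card)
  qed
  then have "best_tuple I Z"
    using I I_max Z_dist Z_coh by (simp add: best_tuple_def admissible_tuple_iff)
  then show ?thesis
    using separating_tuple_triangular [OF r(1) Z_dist tri] F_I F_hom by blast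
qed

end
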